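(* Let $(\Lambda,\Pi,\bot\!\!\!\bot,\mathrm{app},\mathrm{save},\mathrm{push},\mathrm{K},\mathrm{S},\mathrm{cc})$ be a pre-Abstract Krivine Structure (PAKS). Put $A=\mathcal P_\perp(\Pi)$, let $a\le b$ mean $a\supseteq b$, and for $a,b\in A$ let $$a\circ b=\big({}^\perp\{\pi\in\Pi:\ t\perp s.\pi\ \text{ for all } t\in{}^\perp a,\ s\in{}^\perp b\}\big)^\perp,\qquad a\to b=\big({}^\perp\{t.\pi:\ t\in{}^\perp a,\ \pi\in b\}\big)^\perp .$$ Let $\mathrm k=\{\mathrm K\}^\perp$, $\mathrm s=\{\mathrm S\}^\perp$, $\mathrm E=\mathrm S(\mathrm K(\mathrm S\mathrm K\mathrm K))\in\Lambda$ and $\mathrm e=\{\mathrm E\mathrm E\}^\perp$. Then $(A,\le,\circ,\mathrm k,\mathrm s)$ is an ordered combinatory algebra. Moreover, the map $\to$ is an implication, the element $\mathrm e$ is an adjunctor, and if the PAKS is classical then so is the ordered combinatory algebra.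
   Context: A realizability lattice is a triple $(\Lambda,\Pi,\bot\!\!\!\bot)$ with $\Lambda,\Pi$ sets and $\bot\!\!\!\bot\subseteq\Lambda\times\Pi$; write $t\perp\pi$ for $(t,\pi)\in\bot\!\!\!\bot$. For $P\subseteq\Pi$ and $L\subseteq\Lambda$ put ${}^\perp P=\{t\in\Lambda: t\perp\pi\ \forall\pi\in P\}$, $L^\perp=\{\pi\in\Pi: t\perp\pi\ \forall t\in L\}$, and $\mathcal P_\perp(\Pi)=\{P\subseteq\Pi: ({}^\perp P)^\perp=P\}$. A pre-Abstract Krivine Structure (PAKS) consists of a realizability lattice $(\Lambda,\Pi,\bot\!\!\!\bot)$, functions $\mathrm{app}:\Lambda\times\Lambda\to\Lambda$, $(t,u)\mapsto tu$ (associating to the left), $\mathrm{save}:\Pi\to\Lambda$, $\pi\mapsto k_\pi$, $\mathrm{push}:\Lambda\times\Pi\to\Pi$, $(t,\pi)\mapsto t.\pi$ (so $t.s.\pi=t.(s.\pi)$), and elements $\mathrm K,\mathrm S,\mathrm{cc}\in\Lambda$, such that for all $t,s,u\in\Lambda$, $\pi,\pi'\in\Pi$: (S1) if $t\perp s.\pi$ then $ts\perp\pi$; (S2) if $t\perp\pi$ then $\mathrm K\perp t.s.\pi$; (S3) if $tu(su)\perp\pi$ then $\mathrm S\perp t.s.u.\pi$; (S4) if $t\perp k_\pi.\pi$ then $\mathrm{cc}\perp t.\pi$; (S5) if $t\perp\pi$ then $k_\pi\perp t.\pi'$. The PAKS is called classical in the presence of $\mathrm{save}$, $\mathrm{cc}$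 and the axioms (S4), (S5) (which are included in the definition above). An ordered combinatory algebra (OCA) is $(A,\circ,\le,\mathrm k,\mathrm s)$ with $A$ a set, $\circ:A\times A\to A$ a binary operation (application, $a\circ b=ab$, associating to the left), $\le$ a partial order on $A$, and $\mathrm k,\mathrm s\in A$, such that application is monotone in both arguments and $\mathrm kab\le a$, $\mathrm sabc\le ac(bc)$ for all $a,b,c\in A$. An implication on an OCA is a map $\to:A\times A\to A$, monotone in the second variable and antimonotone in the first, such that for all $a,b,c$: $a\le(b\to c)$ implies $ab\le c$. An adjunctor (for an OCA with implication) is an element $\mathrm e\in A$ such that for all $a,b,c\in A$: $ab\le c$ implies $\mathrm ea\le(b\to c)$. An OCA with implication is classic (classical) if there is $\mathrm c\in A$ with $\mathrm c\le(((a\to b)\to a)\to a)$ for all $a,b\in A$. *)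

theory Defs imports Main
begin

section \<open>Realizability lattices\<close>

locale realizability_lattice =
  fixes Terms :: "'t set" and Stacks :: "'p set" and orth :: "('t \<times> 'p) set"
  assumes orth_subset: "orth \<subseteq> Terms \<times> Stacks"

definition left_perp :: "'t set \<Rightarrow> ('t \<times> 'p) set \<Rightarrow> 'p set \<Rightarrow> 't set" where
  "left_perp Terms orth P = {t \<in> Terms. \<forall>\<pi>\<in>P. (t, \<pi>) \<in> orth}"

definition right_perp :: "'p set \<Rightarrow> ('t \<times> 'p) set \<Rightarrow> 't set \<Rightarrow> 'p set" where
  "right_perp Stacks orth L = {\<pi> \<in> Stacks. \<forall>t\<in>L. (t, \<pi>) \<in> orth}"

definition closed_stacks :: "'t set \<Rightarrow> 'p set \<Rightarrow> ('t \<times> 'p) set \<Rightarrow> 'p set set" where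
  "closed_stacks Terms Stacks orth =
     {P. P \<subseteq> Stacks \<and> right_perp Stacks orth (left_perp Terms orth P) = P}"

section \<open>Pre-abstract Krivine structures\<close>

locale paks = realizability_lattice Terms Stacks orth
  for Terms :: "'t set" and Stacks :: "'p set" and orth :: "('t \<times> 'p) set" +
  fixes app :: "'t \<Rightarrow> 't \<Rightarrow> 't"
    and save :: "'p \<Rightarrow> 't"
    and push :: "'t \<Rightarrow> 'p \<Rightarrow> 'p"
    and K S cc :: 't
  assumes app_closed: "\<lbrakk>t \<in> Terms; u \<in> Terms\<rbrakk> \<Longrightarrow> app t u \<in> Terms"
    and save_closed: "\<pi> \<in> Stacks \<Longrightarrow> save \<pi> \<in> Terms"
    and push_closed: "\<lbrakk>t \<in> Terms; \<pi> \<in> Stacks\<rbrakk> \<Longrightarrow> push t \<pi> \<in> Stacks"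
    and K_in: "K \<in> Terms"
    and S_in: "S \<in> Terms"
    and cc_in: "cc \<in> Terms"
    and S1: "\<lbrakk>t \<in> Terms; s \<in> Terms; \<pi> \<in> Stacks; (t, push s \<pi>) \<in> orth\<rbrakk>
        \<Longrightarrow> (app t s, \<pi>) \<in> orth"
    and S2: "\<lbrakk>t \<in> Terms; s \<in> Terms; \<pi> \<in> Stacks; (t, \<pi>) \<in> orth\<rbrakk>
        \<Longrightarrow> (K, push t (push s \<pi>)) \<in> orth"
    and S3: "\<lbrakk>t \<in> Terms; s \<in> Terms; u \<in> Terms; \<pi> \<in> Stacks;
          (app (app t u) (app s u), \<pi>) \<in> orth\<rbrakk>
        \<Longrightarrow> (S, push t (push s (push u \<pi>))) \<in> orth"
    and S4: "\<lbrakk>t \<in> Terms; \<pi> \<in> Stacks; (t, push (save \<pi>) \<pi>) \<in> orth\<rbrakk>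
        \<Longrightarrow> (cc, push t \<pi>) \<in> orth"
    and S5: "\<lbrakk>t \<in> Terms; \<pi> \<in> Stacks; \<pi>' \<in> Stacks; (t, \<pi>) \<in> orth\<rbrakk>
        \<Longrightarrow> (save \<pi>, push t \<pi>') \<in> orth"

text \<open>
  Classicality of a PAKS is the presence of \<open>save\<close> and \<open>cc\<close> subject to the
  axioms \<open>S4\<close> and \<open>S5\<close>. As these already belong to the definition of a PAKS used
  here, every PAKS is classical; the predicate merely keeps the
  classicality hypothesis visible where it is used.
\<close>

definition classical_paks ::
  "'t set \<Rightarrow> 'p set \<Rightarrow> ('t \<times> 'p) set \<Rightarrow> ('p \<Rightarrow> 't) \<Rightarrow> ('t \<Rightarrow> 'p \<Rightarrow> 'p) \<Rightarrow> 't \<Rightarrow> bool" where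
  "classical_paks Terms Stacks orth save push cc \<longleftrightarrow>
     (\<forall>\<pi>\<in>Stacks. save \<pi> \<in> Terms) \<and> cc \<in> Terms \<and>
     (\<forall>t\<in>Terms. \<forall>\<pi>\<in>Stacks. (t, push (save \<pi>) \<pi>) \<in> orth \<longrightarrow> (cc, push t \<pi>) \<in> orth) \<and>
     (\<forall>t\<in>Terms. \<forall>\<pi>\<in>Stacks. \<forall>\<pi>'\<in>Stacks. (t, \<pi>) \<in> orth \<longrightarrow> (save \<pi>, push t \<pi>') \<in> orth)"

definition stack_app ::
  "'t set \<Rightarrow> 'p set \<Rightarrow> ('t \<times> 'p) set \<Rightarrow> ('t \<Rightarrow> 'p \<Rightarrow> 'p) \<Rightarrow> 'p set \<Rightarrow> 'p set \<Rightarrow> 'p set" where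
  "stack_app Terms Stacks orth push a b =
     right_perp Stacks orth (left_perp Terms orth
       {\<pi> \<in> Stacks. \<forall>t\<in>left_perp Terms orth a. \<forall>s\<in>left_perp Terms orth b.
          (t, push s \<pi>) \<in> orth})"

definition stack_imp ::
  "'t set \<Rightarrow> 'p set \<Rightarrow> ('t \<times> 'p) set \<Rightarrow> ('t \<Rightarrow> 'p \<Rightarrow> 'p) \<Rightarrow> 'p set \<Rightarrow> 'p set \<Rightarrow> 'p set" where
  "stack_imp Terms Stacks orth push a b =
     right_perp Stacks orth (left_perp Terms orth
       {push t \<pi> | t \<pi>. t \<in> left_perp Terms orth a \<and> \<pi> \<in> b})"

definition E_term :: "('t \<Rightarrow> 't \<Rightarrow> 't) \<Rightarrow> 't \<Rightarrow> 't \<Rightarrow> 't" where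
  "E_term app K S = app S (app K (app (app S K) K))"

section \<open>Ordered combinatory algebras\<close>

locale oca =
  fixes A :: "'a set"
    and le :: "'a \<Rightarrow> 'a \<Rightarrow> bool"
    and ap :: "'a \<Rightarrow> 'a \<Rightarrow> 'a"
    and k s :: 'a
  assumes le_refl: "reflp_on A le"
    and le_trans: "transp_on A le"
    and le_antisym: "antisymp_on A le"
    and ap_closed: "\<lbrakk>a \<in> A; b \<in> A\<rbrakk> \<Longrightarrow> ap a b \<in> A"
    and k_in: "k \<in> A"
    and s_in: "s \<in> A"
    and ap_mono: "\<lbrakk>a \<in> A; a' \<in> A; b \<in> A; b' \<in> A; le a a'; le b b'\<rbrakk>
        \<Longrightarrow> le (ap a b) (ap a' b')"
    and k_le: "\<lbrakk>a \<in> A; b \<in> A\<rbrakk> \<Longrightarrow> le (ap (ap k a) b) a"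
    and s_le: "\<lbrakk>a \<in> A; b \<in> A; c \<in> A\<rbrakk>
        \<Longrightarrow> le (ap (ap (ap s a) b) c) (ap (ap a c) (ap b c))"

locale oca_with_implication = oca A le ap k s
  for A :: "'a set" and le :: "'a \<Rightarrow> 'a \<Rightarrow> bool" and ap :: "'a \<Rightarrow> 'a \<Rightarrow> 'a" and k s :: 'a +
  fixes imp :: "'a \<Rightarrow> 'a \<Rightarrow> 'a"
  assumes imp_closed: "\<lbrakk>a \<in> A; b \<in> A\<rbrakk> \<Longrightarrow> imp a b \<in> A"
    and imp_mono: "\<lbrakk>a \<in> A; b \<in> A; b' \<in> A; le b b'\<rbrakk> \<Longrightarrow> le (imp a b) (imp a b')"
    and imp_antimono: "\<lbrakk>a \<in> A; a' \<in> A; b \<in> A; le a a'\<rbrakk> \<Longrightarrow> le (imp a' b) (imp a b)"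
    and imp_adjoint: "\<lbrakk>a \<in> A; b \<in> A; c \<in> A; le a (imp b c)\<rbrakk> \<Longrightarrow> le (ap a b) c"

definition adjunctor ::
  "'a set \<Rightarrow> ('a \<Rightarrow> 'a \<Rightarrow> bool) \<Rightarrow> ('a \<Rightarrow> 'a \<Rightarrow> 'a) \<Rightarrow> ('a \<Rightarrow> 'a \<Rightarrow> 'a) \<Rightarrow> 'a \<Rightarrow> bool" where
  "adjunctor A le ap imp e \<longleftrightarrow>
     e \<in> A \<and> (\<forall>a\<in>A. \<forall>b\<in>A. \<forall>c\<in>A. le (ap a b) c \<longrightarrow> le (ap e a) (imp b c))"

definition classical_oca ::
  "'a set \<Rightarrow> ('a \<Rightarrow> 'a \<Rightarrow> bool) \<Rightarrow> ('a \<Rightarrow> 'a \<Rightarrow> 'a) \<Rightarrow> bool" where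
  "classical_oca A le imp \<longleftrightarrow>
     (\<exists>c\<in>A. \<forall>a\<in>A. \<forall>b\<in>A. le c (imp (imp (imp a b) a) a))"

end

theory Submission imports Defs
begin

text \<open>
  A closed set \<open>a\<close> of stacks is determined by the terms orthogonal to it, which are said to realize
  \<open>a\<close>; ordering closed sets by reverse inclusion is ordering their sets of realizing terms by
  inclusion. Write \<open>D a b\<close> for the set of stacks whose closure is \<open>a \<circ> b\<close>. Two remarks reduce the
  clauses on application to statements about single stacks.

  To show that \<open>a \<circ> b\<close> lies \<^emph>\<open>below\<close> something, stacks have to be put into \<open>a \<circ> b\<close>. It suffices
  to put them into \<open>D a b\<close>, and \<open>\<pi>\<close> belongs to \<open>D a b\<close> as soon as \<open>s.\<pi> \<in> a\<close> for all terms \<open>s\<close>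
  realizing \<open>b\<close> (\<open>in_sappI\<close>). Thus a stack is put into \<open>k a b\<close>, \<open>s a b c\<close> or \<open>e a\<close> by pushing
  terms that realize the arguments onto it one by one, until only a condition on the single
  combinator remains, which is what (S2), (S3) or the execution rule of \<open>EE\<close> provides.

  To exploit that a stack \<open>\<pi>\<close> \<^emph>\<open>is\<close> in \<open>a \<circ> b\<close>, axiom (S1) is used: it implies that \<open>ts\<close>
  realizes \<open>a \<circ> b\<close> whenever \<open>t\<close> realizes \<open>a\<close> and \<open>s\<close> realizes \<open>b\<close> (\<open>app_realizes\<close>), so that
  \<open>ts \<bottom> \<pi>\<close>.

  Since (S1) is an implication only, a stack orthogonal to every \<open>ts\<close> need not belong to \<open>D a b\<close>,
  and from \<open>ab \<le> c\<close> one cannot conclude \<open>a \<le> (b \<rightarrow> c)\<close>. This is repaired by a combinator that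
  eta-expands: \<open>E \<bottom> t.s.\<pi>\<close> whenever \<open>ts \<bottom> \<pi>\<close>, and \<open>EE\<close> inherits this rule (\<open>EE_orth\<close>).

  The proof of Peirce's law is the usual one: if \<open>\<pi> \<in> a\<close>, then \<open>k\<^sub>\<pi>\<close> realizes \<open>a \<rightarrow> b\<close> by (S5), so
  every term realizing \<open>(a \<rightarrow> b) \<rightarrow> a\<close> is orthogonal to \<open>k\<^sub>\<pi>.\<pi>\<close>, which is the premise of (S4).
\<close>

context paks
begin

section \<open>Polarity\<close>

abbreviation realizing :: "'p set \<Rightarrow> 't set" where
  "realizing \<equiv> left_perp Terms orth"

abbreviation refuters :: "'t set \<Rightarrow> 'p set" where
  "refuters \<equiv> right_perp Stacks orth"

abbreviation closed :: "'p set set" where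
  "closed \<equiv> closed_stacks Terms Stacks orth"

abbreviation sapp :: "'p set \<Rightarrow> 'p set \<Rightarrow> 'p set" where
  "sapp \<equiv> stack_app Terms Stacks orth push"

abbreviation arrow :: "'p set \<Rightarrow> 'p set \<Rightarrow> 'p set" where
  "arrow \<equiv> stack_imp Terms Stacks orth push"

lemma realizing_Terms: "t \<in> realizing P \<Longrightarrow> t \<in> Terms"
  by (simp add: left_perp_def)

lemma realizing_orth: "\<lbrakk>t \<in> realizing P; \<pi> \<in> P\<rbrakk> \<Longrightarrow> (t, \<pi>) \<in> orth"
  by (simp add: left_perp_def)

lemma realizing_antimono: "P \<subseteq> Q \<Longrightarrow> realizing Q \<subseteq> realizing P"
  by (auto simp: left_perp_def)

lemma refuters_antimono: "L \<subseteq> M \<Longrightarrow> refuters M \<subseteq> refuters L"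
  by (auto simp: right_perp_def)

lemma subset_closure: "P \<subseteq> Stacks \<Longrightarrow> P \<subseteq> refuters (realizing P)"
  by (auto simp: left_perp_def right_perp_def)

lemma realizing_closure:
  assumes "P \<subseteq> Stacks"
  shows "realizing (refuters (realizing P)) = realizing P"
  using assms by (auto simp: left_perp_def right_perp_def)

lemma refuters_closed: "L \<subseteq> Terms \<Longrightarrow> refuters L \<in> closed"
  by (auto simp: closed_stacks_def left_perp_def right_perp_def)

lemma closed_Stacks: "\<lbrakk>a \<in> closed; \<pi> \<in> a\<rbrakk> \<Longrightarrow> \<pi> \<in> Stacks"
  by (auto simp: closed_stacks_def)

lemma closure_least: "\<lbrakk>P \<subseteq> a; a \<in> closed\<rbrakk> \<Longrightarrow> refuters (realizing P) \<subseteq> a"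
  using realizing_antimono[of P a] refuters_antimono[of "realizing a" "realizing P"]
  by (auto simp: closed_stacks_def)

section \<open>Application and implication on closed sets\<close>

lemma sapp_closed: "sapp a b \<in> closed"
  unfolding stack_app_def by (rule refuters_closed) (auto simp: left_perp_def)

lemma arrow_closed: "arrow a b \<in> closed"
  unfolding stack_imp_def by (rule refuters_closed) (auto simp: left_perp_def)

lemma in_sappI:
  assumes "\<pi> \<in> Stacks" and "\<And>s. s \<in> realizing b \<Longrightarrow> push s \<pi> \<in> a"
  shows "\<pi> \<in> sapp a b"
proof -
  have "\<pi> \<in> {\<pi> \<in> Stacks. \<forall>t\<in>realizing a. \<forall>s\<in>realizing b. (t, push s \<pi>) \<in> orth}"
    using assms by (auto intro: realizing_orth)
  then show ?thesis
    unfolding stack_app_def by (rule rev_subsetD) (rule subset_closure, blast)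
qed

text \<open>
  The stacks generating \<open>a \<circ> b\<close> are orthogonal to \<open>ts\<close> by (S1), and closing a set of stacks does
  not change the terms orthogonal to it.
\<close>

lemma app_realizes:
  assumes "t \<in> realizing a" "s \<in> realizing b"
  shows "app t s \<in> realizing (sapp a b)"
proof -
  let ?D = "{\<pi> \<in> Stacks. \<forall>t\<in>realizing a. \<forall>s\<in>realizing b. (t, push s \<pi>) \<in> orth}"
  have "app t s \<in> realizing ?D"
    using assms
    by (auto simp: left_perp_def[of _ _ ?D] intro: app_closed S1 realizing_Terms)
  then show ?thesis
    unfolding stack_app_def by (subst realizing_closure) auto
qed

lemma sapp_mono:
  assumes "a' \<subseteq> a" "b' \<subseteq> b"
  shows "sapp a' b' \<subseteq> sapp a b"
  unfolding stack_app_def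
  by (intro refuters_antimono realizing_antimono)
     (use realizing_antimono[OF assms(1)] realizing_antimono[OF assms(2)] in blast)

lemma arrow_mono:
  assumes "a \<subseteq> a'" "b' \<subseteq> b"
  shows "arrow a' b' \<subseteq> arrow a b"
  unfolding stack_imp_def
  by (intro refuters_antimono realizing_antimono)
     (use realizing_antimono[OF assms(1)] assms(2) in blast)

lemma push_in_arrow:
  assumes "b \<in> closed" "t \<in> realizing a" "\<pi> \<in> b"
  shows "push t \<pi> \<in> arrow a b"
proof -
  have "{push t \<pi> | t \<pi>. t \<in> realizing a \<and> \<pi> \<in> b} \<subseteq> Stacks"
    using assms(1) by (auto intro: push_closed realizing_Terms closed_Stacks)
  then show ?thesis
    unfolding stack_imp_def using assms(2,3) by (blast dest: subset_closure)
qed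

lemma arrow_least:
  assumes "c \<in> closed" and "\<And>t \<pi>. \<lbrakk>t \<in> realizing a; \<pi> \<in> b\<rbrakk> \<Longrightarrow> push t \<pi> \<in> c"
  shows "arrow a b \<subseteq> c"
  unfolding stack_imp_def by (rule closure_least) (use assms in auto)

lemma realizes_arrowI:
  assumes "b \<in> closed" "t \<in> Terms"
    and "\<And>s \<pi>. \<lbrakk>s \<in> realizing a; \<pi> \<in> b\<rbrakk> \<Longrightarrow> (t, push s \<pi>) \<in> orth"
  shows "t \<in> realizing (arrow a b)"
proof -
  have "arrow a b \<subseteq> refuters {t}"
  proof (rule arrow_least)
    show "refuters {t} \<in> closed"
      using assms(2) by (simp add: refuters_closed)
  next
    fix s \<pi> assume "s \<in> realizing a" "\<pi> \<in> b"
    then show "push s \<pi> \<in> refuters {t}"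
      using assms(1,3) by (auto simp: right_perp_def intro: push_closed realizing_Terms closed_Stacks)
  qed
  then show ?thesis
    using assms(2) by (auto simp: left_perp_def right_perp_def)
qed

lemma sapp_arrow_adjoint:
  assumes "c \<in> closed" "arrow b c \<subseteq> a"
  shows "c \<subseteq> sapp a b"
proof
  fix \<pi> assume "\<pi> \<in> c"
  then show "\<pi> \<in> sapp a b"
    using assms by (intro in_sappI) (auto intro: closed_Stacks push_in_arrow)
qed

section \<open>The combinators\<close>

lemma K_law:
  assumes "a \<in> closed"
  shows "a \<subseteq> sapp (sapp (refuters {K}) a) b"
proof
  fix \<pi> assume "\<pi> \<in> a"
  then have \<pi>: "\<pi> \<in> Stacks" using assms by (rule closed_Stacks[rotated])
  have "push t (push s \<pi>) \<in> refuters {K}" if "t \<in> realizing a" "s \<in> realizing b" for t s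
    using that \<pi> \<open>\<pi> \<in> a\<close>
    by (auto simp: right_perp_def intro: S2 push_closed realizing_Terms realizing_orth)
  then show "\<pi> \<in> sapp (sapp (refuters {K}) a) b"
    using \<pi> by (auto intro!: in_sappI push_closed intro: realizing_Terms)
qed

lemma S_law: "sapp (sapp a c) (sapp b c) \<subseteq> sapp (sapp (sapp (refuters {S}) a) b) c"
proof
  fix \<pi> assume \<pi>_in: "\<pi> \<in> sapp (sapp a c) (sapp b c)"
  then have \<pi>: "\<pi> \<in> Stacks" by (rule closed_Stacks[OF sapp_closed])
  have "push t (push s (push u \<pi>)) \<in> refuters {S}"
    if tsu: "t \<in> realizing a" "s \<in> realizing b" "u \<in> realizing c" for t s u
  proof -
    have "app (app t u) (app s u) \<in> realizing (sapp (sapp a c) (sapp b c))"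
      using tsu by (intro app_realizes)
    then have "(app (app t u) (app s u), \<pi>) \<in> orth"
      using \<pi>_in by (rule realizing_orth)
    then show ?thesis
      using tsu \<pi> by (auto simp: right_perp_def intro: S3 push_closed realizing_Terms)
  qed
  then show "\<pi> \<in> sapp (sapp (sapp (refuters {S}) a) b) c"
    using \<pi> by (auto intro!: in_sappI push_closed intro: realizing_Terms)
qed

text \<open>Run against \<open>u.\<pi>\<close>, \<open>SKK\<close> becomes \<open>Ku(Ku)\<close>, where \<open>K\<close> discards the second copy of \<open>Ku\<close>.\<close>

lemma SKK_orth:
  assumes "u \<in> Terms" "\<pi> \<in> Stacks" "(u, \<pi>) \<in> orth"
  shows "(app (app S K) K, push u \<pi>) \<in> orth"
proof -
  have Ku: "app K u \<in> Terms" using assms(1) K_in by (intro app_closed)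
  have "(K, push u (push (app K u) \<pi>)) \<in> orth"
    using assms Ku by (intro S2)
  then have "(app (app K u) (app K u), \<pi>) \<in> orth"
    using assms Ku K_in by (intro S1 push_closed)
  then have "(S, push K (push K (push u \<pi>))) \<in> orth"
    using assms K_in by (intro S3)
  then show ?thesis
    using assms K_in S_in by (intro S1 push_closed app_closed)
qed

lemma E_Terms: "E_term app K S \<in> Terms"
  unfolding E_term_def using K_in S_in by (intro app_closed)

text \<open>
  Since \<open>E\<close> reduces \<open>t.s.\<pi>\<close> through \<open>K(SKK)s(ts)\<close> to \<open>SKK\<close> against \<open>ts.\<pi>\<close>, it turns the
  converse of (S1) into an execution rule.
\<close>

lemma E_orth:
  assumes "t \<in> Terms" "s \<in> Terms" "\<pi> \<in> Stacks" "(app t s, \<pi>) \<in> orth"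
  shows "(E_term app K S, push t (push s \<pi>)) \<in> orth"
proof -
  let ?I = "app (app S K) K"
  have I: "?I \<in> Terms" and KI: "app K ?I \<in> Terms" and ts: "app t s \<in> Terms"
    using assms K_in S_in by (auto intro: app_closed)
  have "(?I, push (app t s) \<pi>) \<in> orth"
    using ts assms by (intro SKK_orth)
  then have "(K, push ?I (push s (push (app t s) \<pi>))) \<in> orth"
    using I ts assms by (intro S2 push_closed)
  then have "(app (app (app K ?I) s) (app t s), \<pi>) \<in> orth"
    using I KI ts assms K_in S_in by (intro S1 push_closed app_closed)
  then have "(S, push (app K ?I) (push t (push s \<pi>))) \<in> orth"
    using KI assms by (intro S3)
  then show ?thesis
    unfolding E_term_def using KI assms S_in by (intro S1 push_closed)
qed

text \<open>
  Applying the rule for \<open>E\<close> twice: \<open>EE\<close> meets \<open>t.s.\<pi>\<close> as \<open>E\<close> meets \<open>E.t.(s.\<pi>)\<close>, hence as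
  \<open>Et\<close> meets \<open>s.\<pi>\<close>, hence as \<open>E\<close> meets \<open>t.s.\<pi>\<close>.
\<close>

lemma EE_orth:
  assumes "t \<in> Terms" "s \<in> Terms" "\<pi> \<in> Stacks" "(app t s, \<pi>) \<in> orth"
  shows "(app (E_term app K S) (E_term app K S), push t (push s \<pi>)) \<in> orth"
proof -
  have "(app (E_term app K S) t, push s \<pi>) \<in> orth"
    using assms E_orth[OF assms] by (intro S1 push_closed E_Terms)
  then have "(E_term app K S, push (E_term app K S) (push t (push s \<pi>))) \<in> orth"
    using assms by (intro E_orth push_closed E_Terms)
  then show ?thesis
    using assms by (intro S1 push_closed E_Terms)
qed

lemma EE_law:
  assumes "c \<in> closed" "c \<subseteq> sapp a b"
  shows "arrow b c \<subseteq> sapp (refuters {app (E_term app K S) (E_term app K S)}) a"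
proof (rule arrow_least[OF sapp_closed])
  fix s \<pi> assume s: "s \<in> realizing b" and "\<pi> \<in> c"
  then have \<pi>: "\<pi> \<in> Stacks" "\<pi> \<in> sapp a b"
    using assms by (auto intro: closed_Stacks)
  have "push t (push s \<pi>) \<in> refuters {app (E_term app K S) (E_term app K S)}"
    if t: "t \<in> realizing a" for t
  proof -
    have "(app t s, \<pi>) \<in> orth"
      using app_realizes[OF t s] \<pi>(2) by (rule realizing_orth)
    then show ?thesis
      using t s \<pi>(1) by (auto simp: right_perp_def intro: EE_orth push_closed realizing_Terms)
  qed
  then show "push s \<pi> \<in> sapp (refuters {app (E_term app K S) (E_term app K S)}) a"
    using s \<pi>(1) by (auto intro!: in_sappI push_closed intro: realizing_Terms)
qed

text \<open>
  Run against \<open>s.\<pi>'\<close>, the continuation \<open>k\<^sub>\<pi>\<close> throws \<open>\<pi>'\<close> away and runs \<open>s\<close> against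
  \<open>\<pi>\<close>, so only \<open>a\<close> matters and \<open>b\<close> is arbitrary.
\<close>

lemma save_realizes:
  assumes "a \<in> closed" "b \<in> closed" "\<pi> \<in> a"
  shows "save \<pi> \<in> realizing (arrow a b)"
proof (rule realizes_arrowI[OF assms(2)])
  show "save \<pi> \<in> Terms"
    using assms by (auto intro: save_closed closed_Stacks)
next
  fix s \<pi>' assume "s \<in> realizing a" "\<pi>' \<in> b"
  then show "(save \<pi>, push s \<pi>') \<in> orth"
    using assms by (auto intro: S5 realizing_Terms closed_Stacks realizing_orth)
qed

lemma cc_law:
  assumes "a \<in> closed" "b \<in> closed"
  shows "arrow (arrow (arrow a b) a) a \<subseteq> refuters {cc}"
proof (rule arrow_least)
  show "refuters {cc} \<in> closed"
    using cc_in by (simp add: refuters_closed)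
next
  fix t \<pi> assume t: "t \<in> realizing (arrow (arrow a b) a)" and \<pi>_in: "\<pi> \<in> a"
  then have \<pi>: "\<pi> \<in> Stacks" using assms by (auto intro: closed_Stacks)
  have "push (save \<pi>) \<pi> \<in> arrow (arrow a b) a"
    using assms \<pi>_in by (intro push_in_arrow save_realizes)
  then have "(t, push (save \<pi>) \<pi>) \<in> orth"
    using t by (auto intro: realizing_orth)
  then show "push t \<pi> \<in> refuters {cc}"
    using t \<pi> by (auto simp: right_perp_def intro: S4 push_closed realizing_Terms)
qed

section \<open>The ordered combinatory algebra\<close>

lemma oca_with_implication_closed:
  "oca_with_implication closed (\<lambda>a b. b \<subseteq> a) sapp (refuters {K}) (refuters {S}) arrow"
proof
  show "reflp_on closed (\<lambda>a b. b \<subseteq> a)" "transp_on closed (\<lambda>a b. b \<subseteq> a)"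
      "antisymp_on closed (\<lambda>a b. b \<subseteq> a)"
    by (auto simp: reflp_on_def transp_on_def antisymp_on_def)
qed (use K_in S_in in \<open>simp_all add: sapp_closed arrow_closed refuters_closed sapp_mono
      arrow_mono K_law S_law sapp_arrow_adjoint\<close>)

end

theorem theorem6p2:
  fixes Terms :: "'t set" and Stacks :: "'p set" and orth :: "('t \<times> 'p) set"
    and app :: "'t \<Rightarrow> 't \<Rightarrow> 't" and save :: "'p \<Rightarrow> 't" and push :: "'t \<Rightarrow> 'p \<Rightarrow> 'p"
    and K S cc :: 't
  assumes "paks Terms Stacks orth app save push K S cc"
  shows
    "let A = closed_stacks Terms Stacks orth;
         le = (\<lambda>a b :: 'p set. a \<supseteq> b);
         ap = stack_app Terms Stacks orth push;
         imp = stack_imp Terms Stacks orth push;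
         k = right_perp Stacks orth {K};
         s = right_perp Stacks orth {S};
         E = E_term app K S;
         e = right_perp Stacks orth {app E E}
     in oca A le ap k s \<and>
        oca_with_implication A le ap k s imp \<and>
        adjunctor A le ap imp e \<and>
        (classical_paks Terms Stacks orth save push cc \<longrightarrow> classical_oca A le imp)"
proof -
  interpret paks Terms Stacks orth app save push K S cc by fact
  have "adjunctor closed (\<lambda>a b. b \<subseteq> a) sapp arrow
      (refuters {app (E_term app K S) (E_term app K S)})"
    by (simp add: adjunctor_def EE_law refuters_closed app_closed E_Terms)
  moreover have "classical_oca closed (\<lambda>a b. b \<subseteq> a) arrow"
    unfolding classical_oca_def using cc_law cc_in
    by (intro bexI[of _ "refuters {cc}"]) (auto simp: refuters_closed)
  ultimately show ?thesis
    using oca_with_implication_closed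
    by (simp add: Let_def oca_with_implication.axioms(1))
qed

end
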